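(* Let $m\in\mathbb{Z}_{>0}$ and $\beta\in\mathbb{C}(\mathtt{h})^\times$. The element $x^m-\beta\in R$ is left irreducible if and only if, for any prime divisor $p\mid m$, one cannot write $\beta$ as $$\alpha\,\sigma^{\frac{m}{p}}(\alpha)\,\sigma^{2\frac{m}{p}}(\alpha)\cdots\sigma^{(p-1)\frac{m}{p}}(\alpha)$$ with $\alpha\in\mathbb{C}(\mathtt{h})^\times$.
   Context: $R=\mathbb{C}(\mathtt{h})[x,x^{-1},\sigma]$ is the skew Laurent polynomial algebra: the free left $\mathbb{C}(\mathtt{h})$-module with basis $x^i$, $i\in\mathbb{Z}$, with $x^ix^j=x^{i+j}$ and $xa=\sigma(a)x$ for $a\in\mathbb{C}(\mathtt{h})$, where $\sigma$ is the $\mathbb{C}$-automorphism of $\mathbb{C}(\mathtt{h})$ with $\sigma(\mathtt{h})=\mathtt{h}-2$. A non-zero non-invertible $a\in R$ is left irreducible if $Ra$ is a maximal left ideal, i.e. $R/Ra$ is a simple $R$-module. *)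

theory Defs
  imports Complex_Main
    "HOL-Computational_Algebra.Fraction_Field"
    "HOL-Computational_Algebra.Polynomial"
    "HOL-Computational_Algebra.Primes"
begin

section \<open>The field \<open>\<complex>(h)\<close> and its automorphism \<open>\<sigma>\<close>\<close>

type_synonym ratfun = "complex poly fract"

lemma pcompose_linear_eq_0 [simp]: "pcompose p [:c, 1:] = 0 \<longleftrightarrow> p = (0 :: complex poly)"
  by (auto dest: pcompose_eq_0)

text \<open>The substitution \<open>h \<mapsto> h + c\<close>.\<close>

lift_definition shift :: "complex \<Rightarrow> ratfun \<Rightarrow> ratfun"
  is "\<lambda>c q. (pcompose (fst q) [:c, 1:], pcompose (snd q) [:c, 1:])"
  by (auto simp flip: pcompose_mult)

definition sigma :: "ratfun \<Rightarrow> ratfun"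
  where "sigma = shift (-2)"

lemma shift_Fract:
  "shift c (Fraction_Field.Fract p q) =
    Fraction_Field.Fract (pcompose p [:c, 1:]) (pcompose q [:c, 1:])"
  by (simp add: Fraction_Field.Fract.abs_eq shift.abs_eq pcompose_1)

lemma shift_zero [simp]: "shift c 0 = 0"
  by (simp only: Zero_fract_def shift_Fract pcompose_0 pcompose_1)

lemma shift_one [simp]: "shift c 1 = 1"
  by (simp only: One_fract_def shift_Fract pcompose_1)

lemma shift_add [simp]: "shift c (a + b) = shift c a + shift c b"
  by (cases a, cases b) (simp add: shift_Fract pcompose_add pcompose_mult)

lemma shift_mult [simp]: "shift c (a * b) = shift c a * shift c b"
  by (cases a, cases b) (simp add: shift_Fract pcompose_mult)

lemma shift_sum [simp]: "shift c (sum f A) = (\<Sum>x\<in>A. shift c (f x))"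
  by (induction A rule: infinite_finite_induct) auto

lemma shift_by_0 [simp]: "shift 0 a = a"
  by (cases a) (simp add: shift_Fract)

lemma shift_shift [simp]: "shift c (shift d a) = shift (c + d) a"
proof (cases a)
  case (Fract p q)
  have "pcompose [:d, 1:] [:c, 1:] = [:c + d, 1:]"
    by (simp add: pcompose_pCons add.commute)
  then show ?thesis
    by (simp only: Fract shift_Fract pcompose_assoc[symmetric])
qed

lemma sigma_h: "sigma (Fraction_Field.Fract [:0, 1:] 1) = Fraction_Field.Fract [:0, 1:] 1 - 2"
proof -
  have "(2 :: ratfun) = Fraction_Field.Fract 1 1 + Fraction_Field.Fract 1 1"
    by (simp only: fract_collapse one_add_one)
  also have "\<dots> = Fraction_Field.Fract [:2:] 1"
    by (simp add: one_pCons)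
  finally have two: "(2 :: ratfun) = Fraction_Field.Fract [:2:] 1" .
  show ?thesis
    unfolding two sigma_def shift_Fract by (simp add: pcompose_pCons pcompose_1)
qed

lemma sigma_const: "sigma (Fraction_Field.Fract [:c:] 1) = Fraction_Field.Fract [:c:] 1"
  by (simp only: sigma_def shift_Fract pcompose_1 pcompose_const)

lemma inv_sigma: "inv sigma = shift 2"
  by (rule inv_equality) (simp_all add: sigma_def)

lemma bij_sigma: "bij sigma"
  by (rule bij_betw_byWitness[where f' = "shift 2"]) (auto simp: sigma_def)

definition sigma_powi :: "int \<Rightarrow> ratfun \<Rightarrow> ratfun"
  where "sigma_powi i = (if i \<ge> 0 then sigma ^^ nat i else inv sigma ^^ nat (- i))"

lemma shift_funpow: "(shift c ^^ n) a = shift (of_nat n * c) a"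
  by (induction n) (simp_all add: algebra_simps)

lemma sigma_powi_eq_shift: "sigma_powi i = shift (of_int (- 2 * i))"
proof (cases "i \<ge> 0")
  case True
  then obtain n where "i = int n"
    using nonneg_int_cases by blast
  then show ?thesis
    by (auto simp: sigma_powi_def sigma_def shift_funpow fun_eq_iff mult.commute)
next
  case False
  then obtain n where "i = - int n"
    by (metis int_cases4 nat_int of_nat_0_le_iff)
  with False show ?thesis
    by (auto simp: sigma_powi_def inv_sigma shift_funpow fun_eq_iff mult.commute)
qed


section \<open>The skew Laurent polynomial algebra \<open>\<complex>(h)[x, x\<^sup>-\<^sup>1, \<sigma>]\<close>\<close>

text \<open>A finitely supported family \<open>f\<close> stands for \<open>\<Sum>i. f i * x\<^sup>i\<close>, with the
  coefficients on the left.\<close>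

typedef skew_laurent = "{f :: int \<Rightarrow> ratfun. finite {i. f i \<noteq> 0}}"
  morphisms sl_coeff Abs_skew_laurent
  by (rule exI[of _ "\<lambda>_. 0"]) simp

setup_lifting type_definition_skew_laurent

lemma finite_sl_coeff [simp]: "finite {i. sl_coeff f i \<noteq> 0}"
  using sl_coeff[of f] by simp

lemma sl_eqI: "(\<And>i. sl_coeff f i = sl_coeff g i) \<Longrightarrow> f = g"
  by (simp add: sl_coeff_inject[symmetric] fun_eq_iff)

text \<open>The product is forced by \<open>(a x\<^sup>i) (b x\<^sup>j) = a \<sigma>\<^sup>i(b) x\<^sup>i\<^sup>+\<^sup>j\<close>.\<close>

lemma finite_skew_product:
  fixes f g :: "int \<Rightarrow> ratfun"
  assumes f: "finite {i. f i \<noteq> 0}" and g: "finite {i. g i \<noteq> 0}"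
  shows "finite {n. (\<Sum>i | f i \<noteq> 0. f i * sigma_powi i (g (n - i))) \<noteq> 0}"
proof (rule finite_subset)
  show "{n. (\<Sum>i | f i \<noteq> 0. f i * sigma_powi i (g (n - i))) \<noteq> 0}
          \<subseteq> (\<lambda>(i, j). i + j) ` ({i. f i \<noteq> 0} \<times> {j. g j \<noteq> 0})"
  proof
    fix n assume "n \<in> {n. (\<Sum>i | f i \<noteq> 0. f i * sigma_powi i (g (n - i))) \<noteq> 0}"
    then obtain i where "f i \<noteq> 0" "f i * sigma_powi i (g (n - i)) \<noteq> 0"
      by (auto elim: sum.not_neutral_contains_not_neutral)
    then have "f i \<noteq> 0" "g (n - i) \<noteq> 0"
      by (auto simp: sigma_powi_eq_shift)
    then show "n \<in> (\<lambda>(i, j). i + j) ` ({i. f i \<noteq> 0} \<times> {j. g j \<noteq> 0})"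
      by (intro image_eqI[of _ _ "(i, n - i)"]) auto
  qed
qed (use f g in auto)

lemma finite_support_binop:
  assumes "finite {i. f i \<noteq> 0}" "finite {i. g i \<noteq> 0}" "c 0 0 = 0"
  shows "finite {i. c (f i) (g i) \<noteq> 0}"
proof (rule finite_subset)
  show "{i. c (f i) (g i) \<noteq> 0} \<subseteq> {i. f i \<noteq> 0} \<union> {i. g i \<noteq> 0}"
    using assms(3) by (auto intro: ccontr)
qed (use assms in simp)

instantiation skew_laurent :: ring_1
begin

lift_definition zero_skew_laurent :: skew_laurent is "\<lambda>_. 0"
  by simp

lift_definition one_skew_laurent :: skew_laurent is "\<lambda>i. if i = 0 then 1 else 0"
  by simp

lift_definition plus_skew_laurent :: "skew_laurent \<Rightarrow> skew_laurent \<Rightarrow> skew_laurent"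
  is "\<lambda>f g i. f i + g i"
  by (erule (1) finite_support_binop) simp

lift_definition uminus_skew_laurent :: "skew_laurent \<Rightarrow> skew_laurent"
  is "\<lambda>f i. - f i"
  by simp

lift_definition minus_skew_laurent :: "skew_laurent \<Rightarrow> skew_laurent \<Rightarrow> skew_laurent"
  is "\<lambda>f g i. f i - g i"
  by (erule (1) finite_support_binop) simp

lift_definition times_skew_laurent :: "skew_laurent \<Rightarrow> skew_laurent \<Rightarrow> skew_laurent"
  is "\<lambda>f g n. \<Sum>i | f i \<noteq> 0. f i * sigma_powi i (g (n - i))"
  by (rule finite_skew_product)

lemma sl_coeff_times:
  assumes "finite A" "{i. sl_coeff f i \<noteq> 0} \<subseteq> A"
  shows "sl_coeff (f * g) n = (\<Sum>i\<in>A. sl_coeff f i * sigma_powi i (sl_coeff g (n - i)))"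
  unfolding times_skew_laurent.rep_eq using assms by (intro sum.mono_neutral_left) auto

instance
proof
  fix f g h :: skew_laurent
  let ?F = "{i. sl_coeff f i \<noteq> 0}" and ?G = "{i. sl_coeff g i \<noteq> 0}"
  show "f + g + h = f + (g + h)" "f + g = g + f" "0 + f = f" "- f + f = 0" "f - g = f + - g"
    by (transfer; simp add: add_ac)+
  show "(0 :: skew_laurent) \<noteq> 1"
    by transfer (auto simp: fun_eq_iff)
  show "1 * f = f"
    by (rule sl_eqI, subst sl_coeff_times[of "{0}"])
       (auto simp: one_skew_laurent.rep_eq sigma_powi_eq_shift split: if_splits)
  show "f * 1 = f"
  proof (rule sl_eqI)
    fix n
    have "sl_coeff (f * 1) n
            = (\<Sum>i\<in>insert n ?F. sl_coeff f i * sigma_powi i (sl_coeff 1 (n - i)))"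
      by (rule sl_coeff_times) auto
    also have "\<dots> = (\<Sum>i\<in>insert n ?F. if i = n then sl_coeff f i else 0)"
      by (intro sum.cong) (auto simp: one_skew_laurent.rep_eq sigma_powi_eq_shift)
    finally show "sl_coeff (f * 1) n = sl_coeff f n"
      by (simp add: sum.delta)
  qed
  show "(f + g) * h = f * h + g * h"
  proof (rule sl_eqI)
    fix n
    have s: "{i. sl_coeff (f + g) i \<noteq> 0} \<subseteq> ?F \<union> ?G"
      by (auto simp: plus_skew_laurent.rep_eq)
    show "sl_coeff ((f + g) * h) n = sl_coeff (f * h + g * h) n"
      by (simp add: sl_coeff_times[OF _ s] plus_skew_laurent.rep_eq sum.distrib algebra_simps
            sl_coeff_times[of "?F \<union> ?G" f] sl_coeff_times[of "?F \<union> ?G" g])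
  qed
  show "f * (g + h) = f * g + f * h"
    by (rule sl_eqI)
       (simp add: sl_coeff_times[of ?F] plus_skew_laurent.rep_eq sum.distrib algebra_simps
          sigma_powi_eq_shift)
  show "f * g * h = f * (g * h)"
  proof (rule sl_eqI)
    fix n
    define K where "K = (\<lambda>(i, j). i + j) ` (?F \<times> ?G)"
    have finK: "finite K"
      by (auto simp: K_def)
    have K: "{k. sl_coeff (f * g) k \<noteq> 0} \<subseteq> K"
    proof
      fix k assume "k \<in> {k. sl_coeff (f * g) k \<noteq> 0}"
      then obtain i where "sl_coeff f i \<noteq> 0"
          "sl_coeff f i * sigma_powi i (sl_coeff g (k - i)) \<noteq> 0"
        by (auto simp: times_skew_laurent.rep_eq elim: sum.not_neutral_contains_not_neutral)
      then have "sl_coeff f i \<noteq> 0" "sl_coeff g (k - i) \<noteq> 0"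
        by (auto simp: sigma_powi_eq_shift)
      then show "k \<in> K"
        unfolding K_def by (intro image_eqI[of _ _ "(i, k - i)"]) auto
    qed
    let ?t = "\<lambda>i j. sigma_powi i (sl_coeff g j) * sigma_powi (i + j) (sl_coeff h (n - (i + j)))"
    have inner: "(\<Sum>k\<in>K. ?t i (k - i)) = (\<Sum>j\<in>?G. ?t i j)" if "i \<in> ?F" for i
    proof -
      have "(\<Sum>j\<in>?G. ?t i j) = (\<Sum>k\<in>(+) i ` ?G. ?t i (k - i))"
        by (subst sum.reindex) auto
      also have "\<dots> = (\<Sum>k\<in>K. ?t i (k - i))"
      proof (rule sum.mono_neutral_left[OF finK])
        show "(+) i ` ?G \<subseteq> K"
          using that by (auto simp: K_def)
        show "\<forall>k\<in>K - (+) i ` ?G. ?t i (k - i) = 0"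
        proof
          fix k assume "k \<in> K - (+) i ` ?G"
          then have "sl_coeff g (k - i) = 0"
            by (auto simp: image_iff dest: spec[of _ "k - i"])
          then show "?t i (k - i) = 0"
            by (simp add: sigma_powi_eq_shift)
        qed
      qed
      finally show ?thesis ..
    qed
    have "sl_coeff (f * g * h) n
        = (\<Sum>k\<in>K. (\<Sum>i\<in>?F. sl_coeff f i * sigma_powi i (sl_coeff g (k - i)))
             * sigma_powi k (sl_coeff h (n - k)))"
      by (simp add: sl_coeff_times[OF finK K] times_skew_laurent.rep_eq[of f g])
    also have "\<dots> = (\<Sum>i\<in>?F. sl_coeff f i * (\<Sum>k\<in>K. ?t i (k - i)))"
      unfolding sum_distrib_left sum_distrib_right by (subst sum.swap) (simp add: mult.assoc)
    also have "\<dots> = (\<Sum>i\<in>?F. sl_coeff f i * (\<Sum>j\<in>?G. ?t i j))"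
      using inner by (intro sum.cong refl) (simp only:)
    also have "\<dots> = sl_coeff (f * (g * h)) n"
      by (simp add: times_skew_laurent.rep_eq[of f] times_skew_laurent.rep_eq[of g]
            sigma_powi_eq_shift diff_diff_eq distrib_left)
    finally show "sl_coeff (f * g * h) n = sl_coeff (f * (g * h)) n" .
  qed
qed

end

definition sl_monom :: "ratfun \<Rightarrow> int \<Rightarrow> skew_laurent"
  where "sl_monom a i = Abs_skew_laurent (\<lambda>j. if j = i then a else 0)"

lemma sl_coeff_monom [simp]: "sl_coeff (sl_monom a i) j = (if j = i then a else 0)"
  by (simp add: sl_monom_def Abs_skew_laurent_inverse)

abbreviation sl_const :: "ratfun \<Rightarrow> skew_laurent"
  where "sl_const a \<equiv> sl_monom a 0"

abbreviation sl_x :: skew_laurent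
  where "sl_x \<equiv> sl_monom 1 1"

lemma sl_monom_mult: "sl_monom a i * sl_monom b j = sl_monom (a * sigma_powi i b) (i + j)"
  by (rule sl_eqI, subst sl_coeff_times[of "{i}"])
     (auto simp: sigma_powi_eq_shift split: if_splits)

lemma sl_monom_one: "sl_monom 1 0 = 1"
  by (rule sl_eqI) (simp add: one_skew_laurent.rep_eq)

lemma sl_x_mult_const: "sl_x * sl_const a = sl_const (sigma a) * sl_x"
  by (simp add: sl_monom_mult sigma_powi_eq_shift sigma_def)

lemma sl_x_power: "sl_x ^ n = sl_monom 1 (int n)"
  by (induction n) (simp_all add: sl_monom_one sl_monom_mult sigma_powi_eq_shift)


section \<open>Left irreducible elements\<close>

definition left_ideal :: "'a :: ring_1 set \<Rightarrow> bool"
  where "left_ideal I \<longleftrightarrow>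
    0 \<in> I \<and> (\<forall>a\<in>I. \<forall>b\<in>I. a + b \<in> I) \<and> (\<forall>r. \<forall>a\<in>I. r * a \<in> I)"

definition maximal_left_ideal :: "'a :: ring_1 set \<Rightarrow> bool"
  where "maximal_left_ideal I \<longleftrightarrow>
    left_ideal I \<and> I \<noteq> UNIV \<and> (\<forall>J. left_ideal J \<and> I \<subseteq> J \<longrightarrow> J = I \<or> J = UNIV)"

definition left_irreducible :: "'a :: ring_1 \<Rightarrow> bool"
  where "left_irreducible a \<longleftrightarrow>
    a \<noteq> 0 \<and> \<not> (\<exists>b. a * b = 1 \<and> b * a = 1) \<and> maximal_left_ideal {r * a | r. True}"

end

theory Submission
  imports Defs "HOL-Computational_Algebra.Fundamental_Theorem_Algebra"
begin

text \<open>If \<open>\<beta>\<close> is the twisted norm of \<open>\<alpha>\<close> with step \<open>d = m / p\<close>, then \<open>x\<^sup>d - \<alpha>\<close> is a proper right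
  factor of \<open>x\<^sup>m - \<beta>\<close>. Conversely, modulo \<open>I = R (x\<^sup>m - \<beta>)\<close> the element \<open>x\<^sup>m\<close> acts on each
  line \<open>\<complex>(h) x\<^sup>i\<close> as a \<open>\<sigma>\<^sup>m\<close>-semilinear map with factor \<open>\<sigma>\<^sup>i(\<beta>)\<close>. An element of minimal support
  in a proper left ideal strictly above \<open>I\<close> links two such lines, that is, it yields \<open>0 < k < m\<close>
  and \<open>a\<close> with \<open>\<sigma>\<^sup>k(\<beta>) / \<beta> = \<sigma>\<^sup>m(a) / a\<close>. The \<open>k\<close> that admit such an \<open>a\<close> form a group
  containing \<open>m\<close>, so \<open>k\<close> may be replaced by \<open>d = gcd k m\<close>. Then \<open>\<beta>\<close> and the norm of \<open>a\<close> with step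
  \<open>d\<close> differ by a factor fixed by \<open>\<sigma>\<^sup>d\<close>, i.e. a complex number, which is absorbed into \<open>a\<close>
  by extracting a root.\<close>

section \<open>The powers of \<open>\<sigma>\<close>\<close>

lemma sigma_powi_mult [simp]: "sigma_powi i (a * b) = sigma_powi i a * sigma_powi i b"
  by (simp add: sigma_powi_eq_shift)

lemma sigma_powi_0 [simp]: "sigma_powi i 0 = 0"
  by (simp add: sigma_powi_eq_shift)

lemma sigma_powi_1 [simp]: "sigma_powi i 1 = 1"
  by (simp add: sigma_powi_eq_shift)

lemma sigma_powi_zero [simp]: "sigma_powi 0 a = a"
  by (simp add: sigma_powi_eq_shift)

lemma sigma_powi_comp [simp]: "sigma_powi i (sigma_powi j a) = sigma_powi (i + j) a"
  by (simp add: sigma_powi_eq_shift algebra_simps)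

lemma sigma_powi_eq_0_iff [simp]: "sigma_powi i a = 0 \<longleftrightarrow> a = 0"
  by (metis add.left_inverse sigma_powi_0 sigma_powi_comp sigma_powi_zero)

lemma sigma_powi_inverse [simp]: "sigma_powi i (inverse a) = inverse (sigma_powi i a)"
proof (cases "a = 0")
  case False
  then have "sigma_powi i (inverse a) * sigma_powi i a = 1"
    by (simp flip: sigma_powi_mult)
  then show ?thesis
    by (metis inverse_unique mult.commute)
qed simp

lemma sigma_powi_divide [simp]: "sigma_powi i (a / b) = sigma_powi i a / sigma_powi i b"
  by (simp add: divide_inverse)

lemma funpow_sigma: "sigma ^^ n = sigma_powi (int n)"
  by (simp add: sigma_powi_def)

text \<open>With \<open>a = P / Q\<close>, the hypothesis keeps the value of \<open>P / Q\<close>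
  constant along the points \<open>n * c\<close> past the last one that is a root of
  \<open>Q\<close>. So \<open>P - smult r Q\<close> has infinitely many roots and vanishes.\<close>

lemma shift_eq_self_imp_const:
  assumes c: "c \<noteq> 0" and a: "shift c a = a"
  obtains r where "a = Fraction_Field.Fract [:r:] 1"
proof (cases a)
  case (Fract P Q)
  have step: "poly P (z + c) * poly Q z = poly P z * poly Q (z + c)" for z
  proof -
    have "pcompose P [:c, 1:] * Q = P * pcompose Q [:c, 1:]"
      using a Fract by (simp add: shift_Fract eq_fract)
    from arg_cong[OF this, of "\<lambda>p. poly p z"] show ?thesis
      by (simp add: poly_pcompose add.commute)
  qed
  let ?z = "\<lambda>n::nat. of_nat n * c"
  have inj: "inj ?z"
    using c by (auto simp: inj_on_def)
  have "finite {n. poly Q (?z n) = 0}"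
    using finite_vimageI[OF poly_roots_finite[OF \<open>Q \<noteq> 0\<close>] inj] by (simp add: vimage_def)
  then obtain N where N: "\<And>n. poly Q (?z n) = 0 \<Longrightarrow> n < N"
    using finite_nat_set_iff_bounded by auto
  have Q: "poly Q (?z (N + n)) \<noteq> 0" for n
    using N[of "N + n"] by auto
  define r where "r = poly P (?z N) / poly Q (?z N)"
  have "poly P (?z (N + n)) = r * poly Q (?z (N + n))" for n
  proof (induction n)
    case 0
    then show ?case using Q[of 0] by (simp add: r_def)
  next
    case (Suc n)
    then show ?case
      using step[of "?z (N + n)"] Q[of n] Q[of "Suc n"] by (simp add: algebra_simps)
  qed
  then have "(\<lambda>n. ?z (N + n)) ` UNIV \<subseteq> {z. poly (P - smult r Q) z = 0}"
    by auto
  moreover have "inj (\<lambda>n. ?z (N + n))"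
    using c by (auto simp: inj_on_def)
  ultimately have "infinite {z. poly (P - smult r Q) z = 0}"
    using finite_subset range_inj_infinite by blast
  then have "P - smult r Q = 0"
    using poly_roots_finite by blast
  then have "a = Fraction_Field.Fract [:r:] 1"
    using Fract by (simp add: eq_fract)
  then show ?thesis
    by (rule that)
qed

lemma sigma_powi_const [simp]:
  "sigma_powi i (Fraction_Field.Fract [:c:] 1) = Fraction_Field.Fract [:c:] 1"
  by (simp add: sigma_powi_eq_shift shift_Fract pcompose_1 pcompose_const)

lemma Fract_const_power: "Fraction_Field.Fract [:c:] 1 ^ n = Fraction_Field.Fract [:c ^ n:] 1"
  by (induction n) (simp_all add: fract_collapse one_pCons[symmetric] mult.commute)

section \<open>Twisted norms\<close>

text \<open>This is the value that \<open>x^(k*d)\<close> takes modulo the left ideal generated by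
  \<open>x^d - a\<close>. With \<open>k = p\<close> and \<open>d = m div p\<close> it is the product
  in the theorem.\<close>

definition skew_norm :: "nat \<Rightarrow> int \<Rightarrow> ratfun \<Rightarrow> ratfun"
  where "skew_norm k d a = (\<Prod>j<k. sigma_powi (int j * d) a)"

lemma skew_norm_0 [simp]: "skew_norm 0 d a = 1"
  by (simp add: skew_norm_def)

lemma skew_norm_Suc: "skew_norm (Suc k) d a = skew_norm k d a * sigma_powi (int k * d) a"
  by (simp add: skew_norm_def)

lemma skew_norm_eq_0_iff [simp]: "skew_norm k d a = 0 \<longleftrightarrow> k > 0 \<and> a = 0"
  by (auto simp: skew_norm_def)

lemma skew_norm_mult: "skew_norm k d (a * b) = skew_norm k d a * skew_norm k d b"
  by (simp add: skew_norm_def prod.distrib)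

lemma skew_norm_const:
  "skew_norm k d (Fraction_Field.Fract [:c:] 1) = Fraction_Field.Fract [:c ^ k:] 1"
  by (simp add: skew_norm_def Fract_const_power)

lemma skew_norm_add:
  "skew_norm (k + l) d a = skew_norm k d a * sigma_powi (int k * d) (skew_norm l d a)"
  by (induction l) (simp_all add: skew_norm_Suc algebra_simps)

text \<open>Transitivity of norms: it turns a norm with small step \<open>d\<close> into one whose
  number of factors is a prime.\<close>

lemma skew_norm_skew_norm: "skew_norm p (int k * d) (skew_norm k d a) = skew_norm (p * k) d a"
proof (induction p)
  case (Suc p)
  then show ?case
    using skew_norm_add[of "p * k" k d a] by (simp add: skew_norm_Suc add.commute mult.assoc)
qed simp

text \<open>Both sides are the product of \<open>sigma_powi (j * d) a\<close> over \<open>j\<close>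
  from 0 to \<open>k\<close>.\<close>

lemma sigma_powi_skew_norm:
  "sigma_powi d (skew_norm k d a) * a = skew_norm k d a * sigma_powi (int k * d) a"
  by (induction k) (simp_all add: skew_norm_Suc algebra_simps)

text \<open>For nonzero \<open>b\<close> this says that \<open>sigma_powi k b / b\<close> is a
  coboundary for \<open>sigma_powi m\<close>, with denominators cleared.\<close>

definition linked :: "int \<Rightarrow> ratfun \<Rightarrow> int \<Rightarrow> bool"
  where "linked m b k \<longleftrightarrow> (\<exists>a. a \<noteq> 0 \<and> sigma_powi k b * a = b * sigma_powi m a)"

text \<open>Coboundary witnesses compose in the twisted way: that of \<open>k\<close> times
  \<open>sigma_powi k\<close> of that of \<open>l\<close>.\<close>

lemma linked_add:
  assumes "linked m b k" "linked m b l"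
  shows "linked m b (k + l)"
proof -
  obtain u v where u: "u \<noteq> 0" "sigma_powi k b * u = b * sigma_powi m u"
    and v: "v \<noteq> 0" "sigma_powi l b * v = b * sigma_powi m v"
    using assms by (auto simp: linked_def)
  have "sigma_powi (k + l) b * sigma_powi k v = sigma_powi k b * sigma_powi (m + k) v"
    using arg_cong[OF v(2), of "sigma_powi k"] by (simp add: add.commute)
  then have "sigma_powi (k + l) b * (u * sigma_powi k v)
      = (sigma_powi k b * u) * sigma_powi (m + k) v"
    by (simp add: mult_ac)
  then have "sigma_powi (k + l) b * (u * sigma_powi k v) = b * sigma_powi m (u * sigma_powi k v)"
    by (simp only: u(2)) (simp add: mult_ac add.commute)
  then show ?thesis
    using u(1) v(1) by (auto simp: linked_def intro!: exI[of _ "u * sigma_powi k v"])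
qed

lemma linked_minus:
  assumes "linked m b k"
  shows "linked m b (- k)"
proof -
  obtain u where u: "u \<noteq> 0" "sigma_powi k b * u = b * sigma_powi m u"
    using assms by (auto simp: linked_def)
  have "b * sigma_powi (- k) u = sigma_powi (- k) b * sigma_powi (m - k) u"
    using arg_cong[OF u(2), of "sigma_powi (- k)"] by (simp add: add.commute)
  then have "sigma_powi (- k) b * inverse (sigma_powi (- k) u)
      = b * sigma_powi m (inverse (sigma_powi (- k) u))"
    using u(1) by (simp add: field_simps)
  then show ?thesis
    using u(1) by (auto simp: linked_def intro!: exI[of _ "inverse (sigma_powi (- k) u)"])
qed

lemma linked_mult:
  assumes "linked m b k"
  shows "linked m b (u * k)"
proof -
  have nat: "linked m b (int n * l)" if "linked m b l" for n l
  proof (induction n)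
    case 0
    show ?case by (auto simp: linked_def intro!: exI[of _ 1])
  next
    case (Suc n)
    then show ?case using linked_add[OF that Suc] by (simp add: algebra_simps)
  qed
  show ?thesis
    using nat[OF assms, of "nat u"] nat[OF linked_minus[OF assms], of "nat (- u)"]
    by (cases "u \<ge> 0") auto
qed

text \<open>Bezout applies, since linked exponents are closed under sums and integer multiples, and
  \<open>m\<close> is linked with \<open>b\<close> itself as witness.\<close>

lemma linked_gcd:
  assumes "b \<noteq> 0" "linked m b k"
  shows "linked m b (gcd k m)"
proof -
  obtain u v where "u * k + v * m = gcd k m"
    using bezout_int by blast
  moreover have "linked m b m"
    using assms(1) by (auto simp: linked_def intro!: exI[of _ b])
  ultimately show ?thesis
    using linked_add[OF linked_mult[OF assms(2), of u] linked_mult[of m b m v]] by simp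
qed

text \<open>The norm \<open>c\<close> of the witness \<open>u\<close> solves the same equation as
  \<open>b\<close>, so \<open>b / c\<close> is fixed by \<open>sigma_powi d\<close> and is a
  constant \<open>r\<close>. A \<open>k\<close>-th root of \<open>r\<close> has norm
  \<open>r\<close>, so it can be multiplied into \<open>u\<close>.\<close>

lemma linked_step_imp_skew_norm:
  assumes b: "b \<noteq> 0" and k: "k > 0" and d: "d \<noteq> 0" and l: "linked (int k * d) b d"
  obtains a where "b = skew_norm k d a"
proof -
  obtain u where u: "u \<noteq> 0" "sigma_powi d b * u = b * sigma_powi (int k * d) u"
    using l by (auto simp: linked_def)
  define c where "c = skew_norm k d u"
  have c: "c \<noteq> 0" "sigma_powi d c * u = c * sigma_powi (int k * d) u"
    using u(1) sigma_powi_skew_norm by (simp_all add: c_def)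
  have "(sigma_powi d b * c) * u = (b * sigma_powi d c) * u"
    using u(2) c(2) by (simp add: mult_ac)
  then have "sigma_powi d b * c = b * sigma_powi d c"
    using u(1) by simp
  then have "sigma_powi d (b * inverse c) = b * inverse c"
    using c(1) by (simp add: field_simps)
  then obtain r where r: "b * inverse c = Fraction_Field.Fract [:r:] 1"
    using d shift_eq_self_imp_const[of "of_int (- 2 * d)" "b * inverse c"]
    by (auto simp: sigma_powi_eq_shift)
  obtain s where "r = s ^ k"
  proof -
    have "\<not> constant (poly (monom 1 k + [:- r:]))"
      using k by (simp add: constant_degree degree_add_eq_left degree_monom_eq)
    then obtain s where "poly (monom 1 k + [:- r:]) s = 0"
      using fundamental_theorem_of_algebra by blast
    then show ?thesis
      by (intro that[of s]) (simp add: poly_monom)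
  qed
  moreover have "b = Fraction_Field.Fract [:r:] 1 * c"
    using r c(1) by (simp add: field_simps)
  ultimately have "b = skew_norm k d (Fraction_Field.Fract [:s:] 1 * u)"
    by (simp add: skew_norm_mult skew_norm_const c_def)
  then show ?thesis
    by (rule that)
qed

section \<open>The left ideal generated by \<open>x\<^sup>m - \<beta>\<close>\<close>

lemma left_ideal_principal: "left_ideal {r * a | r. True}"
  unfolding left_ideal_def
  by (auto simp flip: distrib_right mult.assoc intro: exI[of _ 0])

lemma left_ideal_diff:
  assumes "left_ideal J" "a \<in> J" "b \<in> J"
  shows "a - b \<in> J"
proof -
  have "- 1 * b \<in> J"
    using assms unfolding left_ideal_def by blast
  then have "a + - 1 * b \<in> J"
    using assms unfolding left_ideal_def by blast
  then show ?thesis by simp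
qed

lemma sl_coeff_zero [simp]: "sl_coeff 0 i = 0"
  by (simp add: zero_skew_laurent.rep_eq)

lemma sl_coeff_add [simp]: "sl_coeff (f + g) i = sl_coeff f i + sl_coeff g i"
  by (simp add: plus_skew_laurent.rep_eq)

lemma sl_coeff_diff [simp]: "sl_coeff (f - g) i = sl_coeff f i - sl_coeff g i"
  by (simp add: minus_skew_laurent.rep_eq)

lemma sl_coeff_monom_times:
  "sl_coeff (sl_monom a i * f) n = a * sigma_powi i (sl_coeff f (n - i))"
  by (subst sl_coeff_times[of "{i}"]) (auto split: if_splits)

lemma sl_coeff_times_monom:
  "sl_coeff (f * sl_monom a i) n = sl_coeff f (n - i) * sigma_powi (n - i) a"
proof -
  have "sl_coeff (f * sl_monom a i) n
      = (\<Sum>j\<in>insert (n - i) {j. sl_coeff f j \<noteq> 0}.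
           sl_coeff f j * sigma_powi j (sl_coeff (sl_monom a i) (n - j)))"
    by (rule sl_coeff_times) auto
  also have "\<dots> = (\<Sum>j\<in>insert (n - i) {j. sl_coeff f j \<noteq> 0}.
           if j = n - i then sl_coeff f j * sigma_powi j a else 0)"
    by (intro sum.cong) auto
  finally show ?thesis
    by (simp add: sum.delta)
qed

lemma sl_eq_sum_monom: "f = (\<Sum>i | sl_coeff f i \<noteq> 0. sl_monom (sl_coeff f i) i)"
proof (rule sl_eqI)
  fix n
  have coeff_sum: "sl_coeff (sum g A) n = (\<Sum>i\<in>A. sl_coeff (g i) n)" for g and A :: "int set"
    by (induction A rule: infinite_finite_induct) simp_all
  show "sl_coeff f n = sl_coeff (\<Sum>i | sl_coeff f i \<noteq> 0. sl_monom (sl_coeff f i) i) n"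
    by (simp add: coeff_sum sum.delta')
qed

section \<open>Division with remainder by \<open>x^m - b\<close>\<close>

lemma sl_coeff_times_binomial:
  "sl_coeff (r * (sl_monom 1 m - sl_const b)) n
     = sl_coeff r (n - m) - sl_coeff r n * sigma_powi n b"
  by (simp add: right_diff_distrib sl_coeff_times_monom)

text \<open>If the support of \<open>r\<close> reaches from \<open>i\<close> to \<open>j\<close>,
  the product has nonzero coefficients at \<open>i\<close> and \<open>j + m\<close>, and a window of
  length \<open>m\<close> cannot hold both.\<close>

lemma times_binomial_eq_0:
  assumes m: "m > 0" and b: "b \<noteq> 0"
    and supp: "\<And>n. sl_coeff (r * (sl_monom 1 m - sl_const b)) n \<noteq> 0 \<Longrightarrow> 0 \<le> n \<and> n < m"
  shows "r = 0"
proof (rule ccontr)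
  assume "r \<noteq> 0"
  define A where "A = {i. sl_coeff r i \<noteq> 0}"
  have A: "finite A" "A \<noteq> {}"
    using \<open>r \<noteq> 0\<close> sl_eqI[of r 0] by (auto simp: A_def)
  have top: "sl_coeff r (Max A) \<noteq> 0" and bot: "sl_coeff r (Min A) \<noteq> 0"
    using Max_in[OF A] Min_in[OF A] by (auto simp: A_def)
  have "Max A + m \<notin> A" "Min A - m \<notin> A"
    using Max_ge[OF A(1), of "Max A + m"] Min_le[OF A(1), of "Min A - m"] m by auto
  then have "sl_coeff r (Max A + m) = 0" "sl_coeff r (Min A - m) = 0"
    by (auto simp: A_def)
  then have "Max A + m < m" "0 \<le> Min A"
    using supp[of "Max A + m"] supp[of "Min A"] top bot b by (auto simp: sl_coeff_times_binomial)
  then show False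
    using Min_le[OF A(1) Max_in[OF A]] by linarith
qed

lemma reduce_mod_binomial:
  fixes m :: int
  assumes m: "m > 0" and b: "b \<noteq> 0"
  shows "\<exists>q r. f = q * (sl_monom 1 m - sl_const b) + r \<and>
           (\<forall>n. sl_coeff r n \<noteq> 0 \<longrightarrow> 0 \<le> n \<and> n < m)"
proof -
  let ?p = "sl_monom 1 m - sl_const b"
  define P where
    "P f \<longleftrightarrow> (\<exists>q r. f = q * ?p + r \<and> (\<forall>n. sl_coeff r n \<noteq> 0 \<longrightarrow> 0 \<le> n \<and> n < m))" for f
  have add: "P (f + g)" if Pf: "P f" and Pg: "P g" for f g
  proof -
    obtain q r where f: "f = q * ?p + r" "\<forall>n. sl_coeff r n \<noteq> 0 \<longrightarrow> 0 \<le> n \<and> n < m"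
      using Pf unfolding P_def by blast
    obtain q' r' where g: "g = q' * ?p + r'" "\<forall>n. sl_coeff r' n \<noteq> 0 \<longrightarrow> 0 \<le> n \<and> n < m"
      using Pg unfolding P_def by blast
    have "f + g = (q + q') * ?p + (r + r')"
      by (simp add: f(1) g(1) distrib_right)
    moreover have "\<forall>n. sl_coeff (r + r') n \<noteq> 0 \<longrightarrow> 0 \<le> n \<and> n < m"
      using f(2) g(2) by (metis add.left_neutral sl_coeff_add)
    ultimately show ?thesis
      unfolding P_def by blast
  qed
  have multiple: "P (q * ?p)" for q
    unfolding P_def by (rule exI[of _ q], rule exI[of _ 0]) simp
  have base: "P (sl_monom a n)" if "0 \<le> n" "n < m" for a n
    unfolding P_def using that by (intro exI[of _ 0] exI[of _ "sl_monom a n"]) simp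
  \<comment> \<open>Modulo multiples of \<open>?p\<close>, \<open>up\<close> lowers an exponent by
    \<open>m\<close> and \<open>down\<close> raises it by \<open>m\<close>; \<open>down\<close>
    divides by \<open>sigma_powi n b\<close>.\<close>
  have up: "sl_monom a (n + m) = sl_monom a n * ?p + sl_monom (a * sigma_powi n b) n" for a n
    by (simp add: right_diff_distrib sl_monom_mult)
  have down: "sl_monom a n = sl_monom (- (a * inverse (sigma_powi n b))) n * ?p
      + sl_monom (a * inverse (sigma_powi n b)) (n + m)" for a n
    using b by (intro sl_eqI) (auto simp: sl_coeff_times_binomial)
  \<comment> \<open>Here \<open>k\<close> counts the steps of length \<open>m\<close> from the
    window. The coefficient stays arbitrary because each step changes it.\<close>
  have "P (sl_monom a (n + int k * m)) \<and> P (sl_monom a (n - int k * m))"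
    if "0 \<le> n" "n < m" for a n k
  proof (induction k arbitrary: a)
    case 0
    then show ?case using base that by simp
  next
    case (Suc k)
    have "P (sl_monom a (n + int k * m + m))"
      by (subst up) (use Suc multiple add in blast)
    moreover have "P (sl_monom a (n - int k * m - m))"
      by (subst down) (use Suc multiple add in auto)
    ultimately show ?case
      by (simp add: algebra_simps)
  qed
  then have "P (sl_monom a (n mod m + (n div m) * m))" for a n
    using m pos_mod_bound[OF m, of n] pos_mod_sign[OF m, of n]
    by (cases "n div m" rule: int_cases2) auto
  then have monom: "P (sl_monom a n)" for a n
    by simp
  have "P (\<Sum>i\<in>A. sl_monom (g i) i)" for g and A :: "int set"
    using multiple[of 0] by (induction A rule: infinite_finite_induct) (auto intro: add monom)
  then have "P f"
    using sl_eq_sum_monom[of f] by metis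
  then show ?thesis
    by (simp add: P_def)
qed

text \<open>A monomial with nonzero coefficient is a unit.\<close>

lemma left_ideal_eq_UNIV:
  assumes J: "left_ideal J" and f: "sl_monom a i \<in> J" and a: "a \<noteq> 0"
  shows "J = UNIV"
proof -
  have "sl_monom (sigma_powi (- i) (inverse a)) (- i) * sl_monom a i = 1"
    using a by (simp add: sl_monom_mult sl_monom_one flip: sigma_powi_mult)
  then have "1 \<in> J"
    using J f unfolding left_ideal_def by metis
  then show ?thesis
    using J unfolding left_ideal_def by (metis UNIV_eq_I mult.right_neutral)
qed

lemma proper_overideal_imp_linked:
  fixes m :: int
  assumes m: "m > 0" and b: "b \<noteq> 0" and J: "left_ideal J" "J \<noteq> UNIV"
    and sub: "{r * (sl_monom 1 m - sl_const b) | r. True} \<subset> J"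
  obtains k where "0 < k" "k < m" "linked m b k"
proof -
  let ?p = "sl_monom 1 m - sl_const b"
  have pJ: "q * ?p \<in> J" for q
    using sub by blast
  define good where "good f \<longleftrightarrow>
    f \<in> J \<and> f \<noteq> 0 \<and> (\<forall>n. sl_coeff f n \<noteq> 0 \<longrightarrow> 0 \<le> n \<and> n < m)" for f
  define size where "size f = card {n. sl_coeff f n \<noteq> 0}" for f
  have "\<exists>f. good f"
  proof -
    obtain g where g: "g \<in> J" "\<And>q. g \<noteq> q * ?p"
      using sub by blast
    obtain q r where qr: "g = q * ?p + r" "\<forall>n. sl_coeff r n \<noteq> 0 \<longrightarrow> 0 \<le> n \<and> n < m"
      using reduce_mod_binomial[OF m b] by blast
    have "r = g - q * ?p"
      using qr(1) by simp
    then have "r \<in> J"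
      using left_ideal_diff[OF J(1) g(1) pJ] by simp
    moreover have "r \<noteq> 0"
      using qr(1) g(2)[of q] by auto
    ultimately show ?thesis
      using qr(2) by (auto simp: good_def)
  qed
  then obtain f where f: "good f" and min: "\<And>g. good g \<Longrightarrow> size f \<le> size g"
    using exists_least_iff[of "\<lambda>n. \<exists>f. good f \<and> size f = n"] by (metis not_less)
  obtain i where i: "sl_coeff f i \<noteq> 0"
    using f sl_eqI[of f 0] by (auto simp: good_def)
  have "\<exists>j. j \<noteq> i \<and> sl_coeff f j \<noteq> 0"
  proof (rule ccontr)
    assume "\<not> ?thesis"
    then have "f = sl_monom (sl_coeff f i) i"
      by (intro sl_eqI) auto
    then show False
      using left_ideal_eq_UNIV[OF J(1) _ i] f J(2) by (metis good_def)
  qed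
  then obtain j where j: "j \<noteq> i" "sl_coeff f j \<noteq> 0"
    by blast
  define s where "s n = sigma_powi m (sl_coeff f n)" for n
  define c where "c = s i * sigma_powi i b * inverse (sl_coeff f i)"
  txt \<open>\<open>x\<^sup>m f\<close> reduced modulo \<open>x\<^sup>m - b\<close>, minus the multiple of \<open>f\<close> that cancels the term at \<open>i\<close>.\<close>
  define g where
    "g = sl_monom 1 m * f - (sl_monom 1 m * f * sl_monom 1 (- m)) * ?p - sl_const c * f"
  \<comment> \<open>Conjugation by \<open>x^m\<close> applies \<open>sigma_powi m\<close> to each
    coefficient, and moving \<open>b\<close> to the left past \<open>x^n\<close> yields
    \<open>sigma_powi n b\<close>.\<close>
  have coeff_g: "sl_coeff g n = s n * sigma_powi n b - c * sl_coeff f n" for n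
    unfolding g_def s_def
    by (simp only: sl_coeff_diff sl_coeff_times_binomial)
       (simp add: sl_coeff_monom_times sl_coeff_times_monom)
  \<comment> \<open>Otherwise \<open>g\<close> would be a good element whose support lies in that of
    \<open>f\<close> but misses \<open>i\<close>, against minimality.\<close>
  have "g = 0"
  proof (rule ccontr)
    assume "g \<noteq> 0"
    have "g \<in> J"
      unfolding g_def using f J(1) pJ by (intro left_ideal_diff) (auto simp: good_def left_ideal_def)
    moreover have "{n. sl_coeff g n \<noteq> 0} \<subseteq> {n. sl_coeff f n \<noteq> 0}"
      by (auto simp: coeff_g s_def)
    moreover have "sl_coeff g i = 0"
      using i by (simp add: coeff_g c_def)
    ultimately have g: "good g" "{n. sl_coeff g n \<noteq> 0} \<subset> {n. sl_coeff f n \<noteq> 0}"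
      using \<open>g \<noteq> 0\<close> f i by (auto simp: good_def)
    show False
      using min[OF g(1)] psubset_card_mono[OF finite_sl_coeff g(2)] by (simp add: size_def)
  qed
  then have eq: "sigma_powi m (sl_coeff f n) * sigma_powi n b = c * sl_coeff f n" for n
    using coeff_g[of n] by (simp add: s_def)
  \<comment> \<open>Comparing \<open>eq\<close> at \<open>l\<close> and \<open>n\<close> eliminates
    \<open>c\<close>; applying \<open>sigma_powi (- n)\<close> then moves the relation to
    \<open>b\<close> itself.\<close>
  have link: "linked m b (l - n)" if l: "sl_coeff f l \<noteq> 0" and n: "sl_coeff f n \<noteq> 0" for l n
  proof -
    let ?t = "sl_coeff f n * inverse (sl_coeff f l)"
    have "sigma_powi l b * ?t = sigma_powi n b * sigma_powi m ?t"
      using eq[of l] eq[of n] l n by (simp add: field_simps)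
    from arg_cong[OF this, of "sigma_powi (- n)"]
    have "sigma_powi (l - n) b * sigma_powi (- n) ?t = b * sigma_powi m (sigma_powi (- n) ?t)"
      by (simp add: add.commute del: sigma_powi_mult) (simp add: add.commute)
    then show ?thesis
      unfolding linked_def using l n by (intro exI[of _ "sigma_powi (- n) ?t"]) auto
  qed
  have "0 \<le> i" "i < m" "0 \<le> j" "j < m"
    using f i j by (auto simp: good_def)
  then show ?thesis
    using that[of "i - j"] that[of "j - i"] link[OF i j(2)] link[OF j(2) i] j(1) by linarith
qed

text \<open>Modulo the left ideal of \<open>x^d - a\<close>, \<open>x^(k*d) * x^d\<close> becomes
  \<open>x^(k*d) * a\<close>, which is \<open>sigma_powi (int k * d) a * x^(k*d)\<close>; this gives
  the induction step.\<close>

lemma binomial_factor: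
  "\<exists>r. sl_monom 1 (int k * d) - sl_const (skew_norm k d a) = r * (sl_monom 1 d - sl_const a)"
proof (induction k)
  case 0
  then show ?case by (auto intro: exI[of _ 0])
next
  case (Suc k)
  then obtain r where
    r: "sl_monom 1 (int k * d) - sl_const (skew_norm k d a) = r * (sl_monom 1 d - sl_const a)"
    by blast
  let ?c = "sigma_powi (int k * d) a"
  have "sl_monom 1 (int (Suc k) * d) - sl_const (skew_norm (Suc k) d a)
      = sl_monom 1 (int k * d) * (sl_monom 1 d - sl_const a)
        + sl_const ?c * (sl_monom 1 (int k * d) - sl_const (skew_norm k d a))"
    by (simp add: right_diff_distrib sl_monom_mult skew_norm_Suc algebra_simps)
  also have "\<dots> = (sl_monom 1 (int k * d) + sl_const ?c * r) * (sl_monom 1 d - sl_const a)"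
    by (simp only: r distrib_right mult.assoc)
  finally show ?case by blast
qed

theorem corollary14:
  fixes m :: nat and \<beta> :: ratfun
  assumes "m > 0" and "\<beta> \<noteq> 0"
  shows "left_irreducible (sl_x ^ m - sl_const \<beta>) \<longleftrightarrow>
    (\<forall>p::nat. prime p \<and> p dvd m \<longrightarrow>
      \<not> (\<exists>\<alpha>::ratfun. \<alpha> \<noteq> 0 \<and> \<beta> = (\<Prod>j<p. (sigma ^^ (j * (m div p))) \<alpha>)))"
proof -
  let ?P = "\<lambda>n b. sl_monom 1 (int n) - sl_const b"
  let ?I = "\<lambda>n b. {r * ?P n b | r. True}"
  have norm: "(\<Prod>j<p. (sigma ^^ (j * (m div p))) \<alpha>) = skew_norm p (int (m div p)) \<alpha>" for p \<alpha>
    by (simp add: skew_norm_def funpow_sigma)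
  \<comment> \<open>Nonzero remainders lie outside the ideal. This is used for \<open>1\<close>, to
    see that ideals are proper, and for \<open>?P d \<alpha>\<close>, to see that an inclusion is
    strict.\<close>
  have not_in: "f \<notin> ?I n b"
    if "n > 0" "b \<noteq> 0" "f \<noteq> 0" "\<And>i. sl_coeff f i \<noteq> 0 \<Longrightarrow> 0 \<le> i \<and> i < int n" for n b f
    using times_binomial_eq_0[of "int n" b] that by fastforce
  have one: "1 \<notin> ?I n b" if "n > 0" "b \<noteq> 0" for n b
    using that by (intro not_in) (auto simp: one_skew_laurent.rep_eq split: if_splits)
  have "\<not> left_irreducible (?P m \<beta>)"
    if p: "prime p" "p dvd m" and \<alpha>: "\<alpha> \<noteq> 0" "\<beta> = skew_norm p (int (m div p)) \<alpha>" for p \<alpha>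
  proof
    define d where "d = m div p"
    have d: "m = p * d" "0 < d" "d < m"
      using p \<open>m > 0\<close> prime_gt_1_nat[OF p(1)] by (auto simp: d_def)
    assume "left_irreducible (?P m \<beta>)"
    moreover have "?I m \<beta> \<subseteq> ?I d \<alpha>"
    proof -
      obtain r where "?P m \<beta> = r * ?P d \<alpha>"
        using binomial_factor[of p "int d" \<alpha>]
        by (metis \<alpha>(2) d(1) d_def of_nat_mult)
      then show ?thesis
        by (auto simp flip: mult.assoc)
    qed
    ultimately have "?I d \<alpha> = ?I m \<beta> \<or> ?I d \<alpha> = UNIV"
      using left_ideal_principal[of "?P d \<alpha>"]
      unfolding left_irreducible_def maximal_left_ideal_def by metis
    moreover have "?P d \<alpha> \<in> ?I d \<alpha>"
      by (rule CollectI, rule exI[of _ 1]) simp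
    moreover have "?P d \<alpha> \<notin> ?I m \<beta>"
    proof (rule not_in)
      have "sl_coeff (?P d \<alpha>) (int d) = 1"
        using d by simp
      then show "?P d \<alpha> \<noteq> 0" by (metis sl_coeff_zero zero_neq_one)
    qed (use assms d in \<open>auto split: if_splits\<close>)
    moreover have "?I d \<alpha> \<noteq> UNIV"
      using one[OF d(2) \<alpha>(1)] by blast
    ultimately show False by metis
  qed
  moreover have "\<exists>p \<alpha>. prime p \<and> p dvd m \<and> \<alpha> \<noteq> 0 \<and> \<beta> = skew_norm p (int (m div p)) \<alpha>"
    if irr: "\<not> left_irreducible (?P m \<beta>)"
  proof -
    \<comment> \<open>This rules out both an inverse of \<open>?P m \<beta>\<close> and
      \<open>?I m \<beta> = UNIV\<close>, so only maximality can fail.\<close>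
    have 1: "1 \<notin> ?I m \<beta>"
      using one assms by blast
    have "sl_coeff (?P m \<beta>) (int m) = 1"
      using assms by simp
    then have "?P m \<beta> \<noteq> 0"
      by (metis sl_coeff_zero zero_neq_one)
    moreover have "\<not> (\<exists>b. ?P m \<beta> * b = 1 \<and> b * ?P m \<beta> = 1)"
      using 1 by (metis (mono_tags, lifting) mem_Collect_eq)
    ultimately have "\<not> maximal_left_ideal (?I m \<beta>)"
      using irr unfolding left_irreducible_def by blast
    moreover have "?I m \<beta> \<noteq> UNIV"
      using 1 by blast
    ultimately obtain J where "left_ideal J" "?I m \<beta> \<subset> J" "J \<noteq> UNIV"
      using left_ideal_principal[of "?P m \<beta>"] unfolding maximal_left_ideal_def by blast
    then obtain l where l: "0 < l" "l < int m" "linked (int m) \<beta> l"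
      using proper_overideal_imp_linked[of "int m" \<beta> J] assms by auto
    \<comment> \<open>As \<open>0 < l < m\<close>, this is a proper divisor of \<open>m\<close>, so
      the cofactor \<open>k\<close> has a prime factor \<open>p\<close>.\<close>
    define d where "d = gcd (nat l) m"
    have "int d = gcd l (int m)"
      using l by (simp add: d_def gcd_int_def)
    then have link: "linked (int m) \<beta> (int d)"
      using linked_gcd[OF assms(2) l(3)] by simp
    have d: "d > 0" "d dvd m"
      using assms by (auto simp: d_def)
    have "d \<le> nat l"
      using l(1) unfolding d_def by (intro gcd_le1_nat) auto
    then have "d < m"
      using l by linarith
    obtain k where k: "m = d * k"
      using d(2) by (elim dvdE)
    have "k \<noteq> 1" "k > 0"
      using k \<open>d < m\<close> assms by auto
    then obtain p where p: "prime p" "p dvd k"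
      using prime_factor_nat by blast
    obtain q where q: "k = p * q"
      using p(2) by (elim dvdE)
    obtain a where a: "\<beta> = skew_norm k (int d) a"
      using linked_step_imp_skew_norm[of \<beta> k "int d"] assms(2) \<open>k > 0\<close> d link k
      by (auto simp: mult.commute)
    have "m div p = q * d"
      using k q prime_gt_0_nat[OF p(1)] by (simp add: mult_ac)
    \<comment> \<open>Grouping the \<open>k = p * q\<close> factors into \<open>p\<close> blocks of
      length \<open>q\<close> makes the inner norm the required \<open>\<alpha>\<close>.\<close>
    then have "\<beta> = skew_norm p (int (m div p)) (skew_norm q (int d) a)"
      using a q skew_norm_skew_norm[of p q "int d" a] by simp
    moreover have "skew_norm q (int d) a \<noteq> 0"
      using a assms(2) \<open>k > 0\<close> by auto
    moreover have "p dvd m"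
      using p(2) k by simp
    ultimately show ?thesis
      using p(1) by blast
  qed
  ultimately show ?thesis
    unfolding norm sl_x_power by blast
qed

end
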